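(* Let $\alpha:I\subset\mathbb{R}\to E^3$ be a unit speed curve with arc length parameter $s$, curvature $\kappa$, torsion $\tau$, and let $T(s)$, $N(s)$, $B(s)$ be its tangent, normal and binormal vectors in the modified orthogonal frame. For $X\in\{T,N,B\}$ let $s_X$ denote the arc length parameter of the curve $(X)$ given by $s\mapsto X(s)$, let $T_X=\frac{dX}{ds_X}$ be its unit tangent vector, and let $D_{T_X}T_X=\frac{dT_X}{ds_X}$. Let $w=\tau T+B$ be the Darboux vector of $\alpha$ and $\phi$ the angle between $B$ and $w$, with $\sin\phi=\frac{\tau}{\|w\|}$, $\cos\phi=\frac{\kappa}{\|w\|}$. Then the following hold (with $'=\frac{d}{ds}$): (1) $$D_{T_T}T_T=-T+\frac{\tau}{\kappa^2}B.$$ (2) $$D_{T_N}T_N=\frac{\phi'}{\kappa^2\|w\|}\left(\kappa\sin\phi\, T+\cos\phi\, B\right)-\frac{1}{\kappa^2}N.$$ (3) $$D_{T_B}T_B=\frac{1}{\tau}T-\frac{1}{\kappa^2}B.$$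
   Context: $E^3$ is Euclidean 3-space with its standard inner product and vector product. For an analytic unit speed curve $\alpha$ whose curvature $\kappa$ is not identically zero, with torsion $\tau$ and Frenet frame $\{t,n,b\}$ (so $t'=\kappa n$, $n'=-\kappa t+\tau b$, $b'=-\tau n$), the modified orthogonal frame is $$T=\frac{d\alpha}{ds},\qquad N=\frac{dT}{ds},\qquad B=T\times N,$$ so that at points where $\kappa\neq 0$ one has $T=t$, $N=\kappa n$, $B=\kappa b$. It satisfies $\langle T,T\rangle=1$, $\langle N,N\rangle=\langle B,B\rangle=\kappa^2$, $\langle T,N\rangle=\langle T,B\rangle=\langle N,B\rangle=0$, and $$T'=N,\qquad N'=-\kappa^2T+\frac{\kappa'}{\kappa}N+\tau B,\qquad B'=-\tau N+\frac{\kappa'}{\kappa}B.$$ The Darboux vector $w=\tau T+B$, with $\|w\|=\sqrt{\kappa^2+\tau^2}$, is the vector satisfying $T'=w\times T$, $N'=w\times N$, $B'=w\times B$; it is introduced under the condition $\kappa=\text{const}$. *)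

theory Defs
  imports "HOL-Analysis.Analysis"
begin

text \<open>Curves live on a (not necessarily open) interval \<open>I\<close>. All derivatives are taken within \<open>I\<close>;
  they are one-sided at endpoints belonging to \<open>I\<close>.\<close>

definition deriv_in :: "real set \<Rightarrow> (real \<Rightarrow> 'a::real_normed_vector) \<Rightarrow> real \<Rightarrow> 'a" where
  "deriv_in I f s = vector_derivative f (at s within I)"

definition real_analytic_on :: "real set \<Rightarrow> (real \<Rightarrow> 'a::real_normed_vector) \<Rightarrow> bool" where
  "real_analytic_on I f \<longleftrightarrow>
     (\<forall>s\<in>I. \<exists>r>0. \<exists>a :: nat \<Rightarrow> 'a. \<forall>x \<in> I \<inter> ball s r. (\<lambda>k. (x - s) ^ k *\<^sub>R a k) sums f x)"

definition unit_speed_on :: "real set \<Rightarrow> (real \<Rightarrow> 'a::real_normed_vector) \<Rightarrow> bool" where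
  "unit_speed_on I \<alpha> \<longleftrightarrow> (\<forall>s\<in>I. norm (deriv_in I \<alpha> s) = 1)"

text \<open>The classical Frenet apparatus of a unit speed curve. The vectors \<open>n\<close>, \<open>b\<close> and the torsion are
  meaningful only where the curvature does not vanish.\<close>

definition frenet_t :: "real set \<Rightarrow> (real \<Rightarrow> real^3) \<Rightarrow> real \<Rightarrow> real^3" where
  "frenet_t I \<alpha> s = deriv_in I \<alpha> s"

definition curvature :: "real set \<Rightarrow> (real \<Rightarrow> real^3) \<Rightarrow> real \<Rightarrow> real" where
  "curvature I \<alpha> s = norm (deriv_in I (frenet_t I \<alpha>) s)"

definition frenet_n :: "real set \<Rightarrow> (real \<Rightarrow> real^3) \<Rightarrow> real \<Rightarrow> real^3" where
  "frenet_n I \<alpha> s = deriv_in I (frenet_t I \<alpha>) s /\<^sub>R curvature I \<alpha> s"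

definition frenet_b :: "real set \<Rightarrow> (real \<Rightarrow> real^3) \<Rightarrow> real \<Rightarrow> real^3" where
  "frenet_b I \<alpha> s = cross3 (frenet_t I \<alpha> s) (frenet_n I \<alpha> s)"

text \<open>The coefficient in \<open>b' = - \<tau> n\<close>.\<close>

definition torsion :: "real set \<Rightarrow> (real \<Rightarrow> real^3) \<Rightarrow> real \<Rightarrow> real" where
  "torsion I \<alpha> s = - (deriv_in I (frenet_b I \<alpha>) s \<bullet> frenet_n I \<alpha> s)"

text \<open>The modified orthogonal frame; unlike \<open>n\<close> and \<open>b\<close>, the vectors \<open>N\<close> and \<open>B\<close> are not normalised.\<close>

definition frame_T :: "real set \<Rightarrow> (real \<Rightarrow> real^3) \<Rightarrow> real \<Rightarrow> real^3" where
  "frame_T I \<alpha> s = deriv_in I \<alpha> s"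

definition frame_N :: "real set \<Rightarrow> (real \<Rightarrow> real^3) \<Rightarrow> real \<Rightarrow> real^3" where
  "frame_N I \<alpha> s = deriv_in I (frame_T I \<alpha>) s"

definition frame_B :: "real set \<Rightarrow> (real \<Rightarrow> real^3) \<Rightarrow> real \<Rightarrow> real^3" where
  "frame_B I \<alpha> s = cross3 (frame_T I \<alpha> s) (frame_N I \<alpha> s)"

definition darboux :: "real set \<Rightarrow> (real \<Rightarrow> real^3) \<Rightarrow> real \<Rightarrow> real^3" where
  "darboux I \<alpha> s = torsion I \<alpha> s *\<^sub>R frame_T I \<alpha> s + frame_B I \<alpha> s"

text \<open>An angle function between \<open>B\<close> and \<open>w\<close>, oriented by the sign of the torsion
  (note \<open>B \<bullet> w = \<kappa>\<^sup>2 = \<kappa> \<parallel>B\<parallel>\<close>, hence the cosine \<open>\<kappa> / \<parallel>w\<parallel>\<close>). The sine and cosine determine it only modulo \<open>2\<pi>\<close> at each point, so a continuous choice along the curve is required.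
  The principal choice \<open>arctan (\<tau> / \<kappa>)\<close> is one instance when \<open>\<kappa>\<close> has no zeros.\<close>

definition darboux_angle :: "real set \<Rightarrow> (real \<Rightarrow> real^3) \<Rightarrow> (real \<Rightarrow> real) \<Rightarrow> bool" where
  "darboux_angle I \<alpha> \<phi> \<longleftrightarrow> continuous_on I \<phi> \<and>
     (\<forall>s\<in>I. sin (\<phi> s) = torsion I \<alpha> s / norm (darboux I \<alpha> s) \<and>
            cos (\<phi> s) = curvature I \<alpha> s / norm (darboux I \<alpha> s))"

text \<open>\<open>\<sigma>\<close> is an arc length parameter of the curve \<open>X\<close>: its increments are the lengths of the
  corresponding arcs. This fixes \<open>\<sigma>\<close> on \<open>I\<close> up to an additive constant.\<close>

definition arc_length_parameter ::
    "real set \<Rightarrow> (real \<Rightarrow> 'a::real_normed_vector) \<Rightarrow> (real \<Rightarrow> real) \<Rightarrow> bool" where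
  "arc_length_parameter I X \<sigma> \<longleftrightarrow>
     (\<forall>u\<in>I. \<forall>v\<in>I. u \<le> v \<longrightarrow>
        ((\<lambda>x. norm (deriv_in I X x)) has_integral (\<sigma> v - \<sigma> u)) {u..v})"

text \<open>The derivative \<open>df/d\<sigma>\<close> at \<open>s\<close> of a function \<open>f\<close> of \<open>s\<close> with respect to another parameter
  \<open>\<sigma>\<close>. The first conjunct excludes the spurious value 0 produced by division by zero where \<open>\<sigma>\<close> is
  locally constant.\<close>

definition has_deriv_wrt ::
    "real set \<Rightarrow> (real \<Rightarrow> real) \<Rightarrow> (real \<Rightarrow> 'a::real_normed_vector) \<Rightarrow> 'a \<Rightarrow> real \<Rightarrow> bool" where
  "has_deriv_wrt I \<sigma> f D s \<longleftrightarrow>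
     (\<forall>\<^sub>F u in at s within I. \<sigma> u \<noteq> \<sigma> s) \<and>
     ((\<lambda>u. (f u - f s) /\<^sub>R (\<sigma> u - \<sigma> s)) \<longlongrightarrow> D) (at s within I)"

definition deriv_wrt ::
    "real set \<Rightarrow> (real \<Rightarrow> real) \<Rightarrow> (real \<Rightarrow> 'a::real_normed_vector) \<Rightarrow> real \<Rightarrow> 'a" where
  "deriv_wrt I \<sigma> f s = (THE D. has_deriv_wrt I \<sigma> f D s)"

text \<open>With \<open>T\<^sub>X = dX/d\<sigma>\<close> for an arc length parameter \<open>\<sigma>\<close> of \<open>X\<close>, this says that
  \<open>D\<^bsub>T\<^sub>X\<^esub> T\<^sub>X = dT\<^sub>X/d\<sigma>\<close> exists at \<open>s\<close> and equals \<open>D\<close>.\<close>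

definition unit_tangent ::
    "real set \<Rightarrow> (real \<Rightarrow> real) \<Rightarrow> (real \<Rightarrow> 'a::real_normed_vector) \<Rightarrow> real \<Rightarrow> 'a" where
  "unit_tangent I \<sigma> X = deriv_wrt I \<sigma> X"

definition has_tangent_deriv ::
    "real set \<Rightarrow> (real \<Rightarrow> real) \<Rightarrow> (real \<Rightarrow> 'a::real_normed_vector) \<Rightarrow> 'a \<Rightarrow> real \<Rightarrow> bool" where
  "has_tangent_deriv I \<sigma> X D s \<longleftrightarrow> has_deriv_wrt I \<sigma> (unit_tangent I \<sigma> X) D s"

end

theory Submission
  imports Defs
begin

text \<open>Each arc length parameter has derivative \<open>norm X'\<close>, so \<open>D\<^bsub>T\<^sub>X\<^esub> T\<^sub>X = V' / norm X'\<close> for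
  \<open>V = X' / norm X'\<close>. Here \<open>V\<close> is \<open>N / \<kappa>\<close> for \<open>X = T\<close>; for constant \<open>\<kappa>\<close> it is
  \<open>- cos \<phi> T + (sin \<phi> / \<kappa>) B\<close> for \<open>X = N\<close> and \<open>- sgn \<tau> N / \<kappa>\<close> for \<open>X = B\<close>. The results
  then follow from the frame equations for \<open>T'\<close>, \<open>N'\<close>, \<open>B'\<close>. Only the differentiability of the
  angle \<open>\<phi>\<close> is not immediate: it is recovered locally as
  \<open>\<phi> s + arcsin (sin (\<phi> u - \<phi> s))\<close>.\<close>

section \<open>Difference quotients and derivatives of analytic curves on an interval\<close>

text \<open>Brings derivatives into the quotient form in which \<open>has_deriv_wrt\<close> is
  stated.\<close>

lemma has_vector_derivative_tendsto:
  "(f has_vector_derivative D) (at s within S) \<Longrightarrow>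
    ((\<lambda>u. (f u - f s) /\<^sub>R (u - s)) \<longlongrightarrow> D) (at s within S)"
proof -
  assume "(f has_vector_derivative D) (at s within S)"
  then have "((\<lambda>u. norm (f u - f s - (u - s) *\<^sub>R D) / norm (u - s)) \<longlongrightarrow> 0) (at s within S)"
    by (simp add: has_vector_derivative_def has_derivative_iff_norm)
  then have "((\<lambda>u. norm ((f u - f s) /\<^sub>R (u - s) - D)) \<longlongrightarrow> 0) (at s within S)"
  proof (rule Lim_transform_eventually)
    have "norm (f u - f s - (u - s) *\<^sub>R D) / norm (u - s) = norm ((f u - f s) /\<^sub>R (u - s) - D)"
      if "u \<noteq> s" for u
    proof -
      have "f u - f s - (u - s) *\<^sub>R D = (u - s) *\<^sub>R ((f u - f s) /\<^sub>R (u - s) - D)"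
        using that by (simp add: scaleR_diff_right)
      then show ?thesis using that by simp
    qed
    then show "\<forall>\<^sub>F u in at s within S. norm (f u - f s - (u - s) *\<^sub>R D) / norm (u - s) =
        norm ((f u - f s) /\<^sub>R (u - s) - D)"
      by (simp add: eventually_at_filter)
  qed
  then show ?thesis by (simp add: tendsto_norm_zero_iff LIM_zero_iff)
qed

text \<open>Nonempty interior rules out one-point intervals, where limits within \<open>I\<close>
  would be trivial and derivatives not unique.\<close>

locale nondegenerate_interval =
  fixes I :: "real set"
  assumes interval: "is_interval I" and interior_nonempty: "interior I \<noteq> {}"
begin

lemma point_islimpt:
  assumes "s \<in> I"
  shows "s islimpt I"
proof (rule connected_imp_perfect)
  show "connected I" using interval by (simp add: is_interval_connected)
  show "I \<noteq> {x}" for x using interior_nonempty by auto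
qed fact

lemma at_within_nontrivial: "s \<in> I \<Longrightarrow> at s within I \<noteq> bot"
  using point_islimpt by (simp add: trivial_limit_within)

lemma deriv_in_eq:
  assumes "s \<in> I" "(f has_vector_derivative D) (at s within I)"
  shows "deriv_in I f s = D"
  unfolding deriv_in_def by (rule vector_derivative_within[OF at_within_nontrivial assms(2)]) fact

lemma closed_interval_subset:
  assumes "u \<in> I" "v \<in> I"
  shows "{u..v} \<subseteq> I"
  using interval assms by (meson atLeastAtMost_iff mem_is_interval_1_I subsetI)

text \<open>Sums of a power series on a one-sided neighbourhood already force convergence on a full one,
  which makes endpoints of \<open>I\<close> harmless.\<close>

lemma power_series_deriv:
  fixes f :: "real \<Rightarrow> 'a::euclidean_space" and a :: "nat \<Rightarrow> 'a"
  assumes "s \<in> I" "0 < r" and sums: "\<And>x. x \<in> I \<inter> ball s r \<Longrightarrow> (\<lambda>k. (x - s) ^ k *\<^sub>R a k) sums f x"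
  obtains d g where "0 < d"
    "\<And>x. x \<in> I \<inter> ball s d \<Longrightarrow> (f has_vector_derivative g x) (at x within I)"
    "\<And>x. x \<in> I \<inter> ball s d \<Longrightarrow> (\<lambda>k. (x - s) ^ k *\<^sub>R (real (Suc k) *\<^sub>R a (Suc k))) sums g x"
proof -
  obtain y where y: "y \<in> I" "y \<noteq> s" "dist y s < r"
    using point_islimpt[OF \<open>s \<in> I\<close>] \<open>0 < r\<close> unfolding islimpt_approachable by blast
  define d where "d = \<bar>y - s\<bar>"
  have d: "0 < d" "d < r" using y by (auto simp: d_def dist_real_def)
  \<comment> \<open>Termwise differentiation is applied to scalar series, one coordinate at a time;
    \<open>g\<close> reassembles the coordinates.\<close>
  define c where "c = (\<lambda>i k. a k \<bullet> i)"
  have comp: "(\<lambda>k. c i k * (x - s) ^ k) sums (f x \<bullet> i)" if "x \<in> I \<inter> ball s r" for i x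
    using bounded_linear.sums[OF bounded_linear_inner_left sums[OF that], of i]
    by (simp add: c_def mult.commute)
  have K: "summable (\<lambda>k. c i k * (y - s) ^ k)" for i
    using comp[of y i] y by (auto simp: dist_commute sums_iff)
  define g where "g x = (\<Sum>i\<in>Basis. (\<Sum>k. diffs (c i) k * (x - s) ^ k) *\<^sub>R i)" for x
  have g: "g x \<bullet> i = (\<Sum>k. diffs (c i) k * (x - s) ^ k)" if "i \<in> Basis" for x i
    unfolding g_def using that by simp
  show ?thesis
  proof
    show "0 < d" by fact
  next
    fix x assume x: "x \<in> I \<inter> ball s d"
    then have xs: "norm (x - s) < norm (y - s)" by (auto simp: dist_real_def d_def abs_minus_commute)
    show "(f has_vector_derivative g x) (at x within I)"
      unfolding has_vector_derivative_def
    proof (subst has_derivative_componentwise_within, intro ballI)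
      fix i :: 'a assume i: "i \<in> Basis"
      have "((\<lambda>z. \<Sum>k. c i k * (z - s) ^ k) has_field_derivative g x \<bullet> i) (at x)"
        using termdiffs_strong[OF K xs, of i] DERIV_shift[of "\<lambda>z. \<Sum>k. c i k * z ^ k" "g x \<bullet> i" x "- s"]
        unfolding g[OF i] by simp
      then have "((\<lambda>z. \<Sum>k. c i k * (z - s) ^ k) has_derivative (\<lambda>h. h * (g x \<bullet> i))) (at x within I)"
        by (auto simp: has_field_derivative_def mult.commute[of _ "g x \<bullet> i"] intro: has_derivative_at_withinI)
      then have "((\<lambda>z. f z \<bullet> i) has_derivative (\<lambda>h. h * (g x \<bullet> i))) (at x within I)"
      proof (rule has_derivative_transform_within)
        \<comment> \<open>This radius keeps \<open>z\<close> inside \<open>ball s r\<close>, where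
          the series represents \<open>f\<close>.\<close>
        show "0 < r - dist s x" "x \<in> I" using x d by auto
        fix z assume "z \<in> I" "dist z x < r - dist s x"
        then have "z \<in> I \<inter> ball s r" using dist_triangle[of s z x] by (auto simp: dist_commute)
        from comp[OF this] show "(\<Sum>k. c i k * (z - s) ^ k) = f z \<bullet> i" by (simp add: sums_iff)
      qed
      then show "((\<lambda>z. f z \<bullet> i) has_derivative (\<lambda>h. (h *\<^sub>R g x) \<bullet> i)) (at x within I)" by simp
    qed
    show "(\<lambda>k. (x - s) ^ k *\<^sub>R (real (Suc k) *\<^sub>R a (Suc k))) sums g x"
      unfolding sums_def
    proof (subst tendsto_componentwise_iff, intro ballI)
      fix i :: 'a assume i: "i \<in> Basis"
      have "summable (\<lambda>k. diffs (c i) k * (x - s) ^ k)"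
        by (rule termdiff_converges[OF xs powser_inside[OF K]]) simp
      then have "(\<lambda>k. diffs (c i) k * (x - s) ^ k) sums (g x \<bullet> i)"
        by (simp add: g[OF i] summable_sums)
      then show "(\<lambda>n. (\<Sum>k<n. (x - s) ^ k *\<^sub>R (real (Suc k) *\<^sub>R a (Suc k))) \<bullet> i) \<longlonglongrightarrow> g x \<bullet> i"
        by (simp add: sums_def inner_sum_left diffs_def c_def mult_ac)
    qed
  qed
qed

text \<open>The derivative is again given by power series, so the lemma can be iterated: this
  supplies \<open>T\<close>, \<open>N\<close>, \<open>N'\<close> and the derivative of
  \<open>N'\<close>.\<close>

lemma real_analytic_on_deriv:
  fixes f :: "real \<Rightarrow> 'a::euclidean_space"
  assumes "real_analytic_on I f"
  shows "\<And>s. s \<in> I \<Longrightarrow> (f has_vector_derivative deriv_in I f s) (at s within I)"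
    and "real_analytic_on I (deriv_in I f)"
proof -
  have *: "\<exists>d>0. \<exists>b. \<forall>x\<in>I \<inter> ball s d. (f has_vector_derivative deriv_in I f x) (at x within I) \<and>
      (\<lambda>k. (x - s) ^ k *\<^sub>R b k) sums deriv_in I f x" if s: "s \<in> I" for s
  proof -
    obtain r a where "0 < r" "\<And>x. x \<in> I \<inter> ball s r \<Longrightarrow> (\<lambda>k. (x - s) ^ k *\<^sub>R a k) sums f x"
      using assms s unfolding real_analytic_on_def by blast
    from power_series_deriv[OF s this] obtain d g where "0 < d"
      and "\<And>x. x \<in> I \<inter> ball s d \<Longrightarrow> (f has_vector_derivative g x) (at x within I)"
      and "\<And>x. x \<in> I \<inter> ball s d \<Longrightarrow> (\<lambda>k. (x - s) ^ k *\<^sub>R (real (Suc k) *\<^sub>R a (Suc k))) sums g x"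
      by blast
    moreover from this(2) have "g x = deriv_in I f x" if "x \<in> I \<inter> ball s d" for x
      using deriv_in_eq that by fastforce
    ultimately show ?thesis
      by (intro exI[of _ d] conjI exI[of _ "\<lambda>k. real (Suc k) *\<^sub>R a (Suc k)"] ballI) auto
  qed
  show "(f has_vector_derivative deriv_in I f s) (at s within I)" if "s \<in> I" for s
  proof -
    obtain d where "0 < d" and "\<forall>x\<in>I \<inter> ball s d. (f has_vector_derivative deriv_in I f x) (at x within I)"
      using *[OF \<open>s \<in> I\<close>] by blast
    then show ?thesis using that by simp
  qed
  show "real_analytic_on I (deriv_in I f)"
    unfolding real_analytic_on_def
  proof
    fix s assume "s \<in> I"
    from *[OF this] show "\<exists>r>0. \<exists>b. \<forall>x\<in>I \<inter> ball s r. (\<lambda>k. (x - s) ^ k *\<^sub>R b k) sums deriv_in I f x"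
      by blast
  qed
qed

section \<open>Arc length parameters and differentiation with respect to them\<close>

text \<open>The fundamental theorem of calculus within \<open>I\<close>: on a short arc near
  \<open>s\<close> the speed stays within \<open>e\<close> of its value at \<open>s\<close>, so the
  length differs from the linear approximation by at most \<open>e\<close> times the parameter
  increment.\<close>

lemma arc_length_parameter_deriv:
  fixes X :: "real \<Rightarrow> 'a::real_normed_vector"
  assumes \<sigma>: "arc_length_parameter I X \<sigma>" and cont: "continuous_on I (deriv_in I X)" and s: "s \<in> I"
  shows "(\<sigma> has_vector_derivative norm (deriv_in I X s)) (at s within I)"
  unfolding has_vector_derivative_def has_derivative_within_alt2
proof (intro conjI allI impI)
  let ?g = "\<lambda>x. norm (deriv_in I X x)"
  fix e :: real assume "0 < e"
  have "continuous_on I ?g" using cont by (rule continuous_on_norm)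
  then obtain d where d: "0 < d" "\<And>x. x \<in> I \<Longrightarrow> dist x s < d \<Longrightarrow> \<bar>?g x - ?g s\<bar> < e"
    using s \<open>0 < e\<close> unfolding continuous_on_iff dist_real_def by metis
  have arc: "\<bar>(\<sigma> v - \<sigma> u) - (v - u) * ?g s\<bar> \<le> e * (v - u)"
    if uv: "u \<in> I" "v \<in> I" "u \<le> v" and near: "\<And>x. x \<in> {u..v} \<Longrightarrow> dist x s < d" for u v
  proof -
    have "(?g has_integral (\<sigma> v - \<sigma> u)) {u..v}"
      using \<sigma> uv unfolding arc_length_parameter_def by blast
    moreover have "((\<lambda>_. ?g s) has_integral (v - u) * ?g s) {u..v}"
      using has_integral_const_real[of "?g s" u v] uv by simp
    ultimately have "((\<lambda>x. ?g x - ?g s) has_integral (\<sigma> v - \<sigma> u) - (v - u) * ?g s) {u..v}"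
      by (rule has_integral_diff)
    from has_integral_bound_real[OF _ _ this, of e "{}"] show ?thesis
      using d(2) near closed_interval_subset[OF uv(1,2)] uv(3) \<open>0 < e\<close>
      by (auto simp: less_imp_le subset_iff)
  qed
  have "\<bar>\<sigma> y - \<sigma> s - (y - s) * ?g s\<bar> \<le> e * \<bar>y - s\<bar>" if y: "y \<in> I" "dist y s < d" for y
  proof (cases "s \<le> y")
    case True
    then show ?thesis using arc[OF s y(1)] y by (auto simp: dist_real_def)
  next
    \<comment> \<open>To the left of \<open>s\<close> the estimate is applied to
      \<open>{y..s}\<close> and the signs are reversed.\<close>
    case False
    then have "\<bar>(\<sigma> s - \<sigma> y) - (s - y) * ?g s\<bar> \<le> e * (s - y)"
      using arc[OF y(1) s] y by (auto simp: dist_real_def)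
    then show ?thesis using False by (simp add: algebra_simps abs_le_iff)
  qed
  then show "\<forall>\<^sub>F y in at s within I. norm (\<sigma> y - \<sigma> s - (y - s) *\<^sub>R ?g s) \<le> e * norm (y - s)"
    unfolding eventually_at using d(1) by (auto intro!: exI[of _ d])
qed (rule bounded_linear_scaleR_left)

lemma has_deriv_wrt_unique:
  assumes "s \<in> I" "has_deriv_wrt I \<sigma> f D s" "has_deriv_wrt I \<sigma> f D' s"
  shows "D = D'"
  using assms tendsto_unique[OF at_within_nontrivial] unfolding has_deriv_wrt_def by blast

text \<open>A quotient of two difference quotients in \<open>u - s\<close>. Since
  \<open>m \<noteq> 0\<close>, the quotient of \<open>\<sigma>\<close> is nonzero near
  \<open>s\<close>, which gives the first conjunct of \<open>has_deriv_wrt\<close>.\<close>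

lemma has_deriv_wrtI:
  fixes f :: "real \<Rightarrow> 'a::real_normed_vector"
  assumes "s \<in> I" and f: "(f has_vector_derivative D) (at s within I)"
    and \<sigma>: "(\<sigma> has_vector_derivative m) (at s within I)" and "m \<noteq> 0"
  shows "has_deriv_wrt I \<sigma> f (D /\<^sub>R m) s"
proof -
  have F: "((\<lambda>u. (f u - f s) /\<^sub>R (u - s)) \<longlongrightarrow> D) (at s within I)"
    using f by (simp add: has_vector_derivative_tendsto)
  have S: "((\<lambda>u. (\<sigma> u - \<sigma> s) / (u - s)) \<longlongrightarrow> m) (at s within I)"
    using has_vector_derivative_tendsto[OF \<sigma>] by (simp add: divide_inverse mult.commute)
  have ne: "\<forall>\<^sub>F u in at s within I. u \<noteq> s" by (simp add: eventually_at_filter)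
  have "\<forall>\<^sub>F u in at s within I. (\<sigma> u - \<sigma> s) / (u - s) \<noteq> 0"
    by (rule tendsto_imp_eventually_ne[OF S \<open>m \<noteq> 0\<close>])
  then have 1: "\<forall>\<^sub>F u in at s within I. \<sigma> u \<noteq> \<sigma> s" by eventually_elim auto
  have "((\<lambda>u. ((f u - f s) /\<^sub>R (u - s)) /\<^sub>R ((\<sigma> u - \<sigma> s) / (u - s))) \<longlongrightarrow> D /\<^sub>R m) (at s within I)"
    by (intro tendsto_intros F S \<open>m \<noteq> 0\<close>)
  then have 2: "((\<lambda>u. (f u - f s) /\<^sub>R (\<sigma> u - \<sigma> s)) \<longlongrightarrow> D /\<^sub>R m) (at s within I)"
    by (rule Lim_transform_eventually) (use 1 ne in eventually_elim, simp add: inverse_eq_divide)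
  from 1 2 show ?thesis unfolding has_deriv_wrt_def by blast
qed

lemma unit_tangent_eq:
  assumes "s \<in> I" "(X has_vector_derivative X') (at s within I)"
    and "(\<sigma> has_vector_derivative norm X') (at s within I)" "X' \<noteq> 0"
  shows "unit_tangent I \<sigma> X s = X' /\<^sub>R norm X'"
proof -
  have "has_deriv_wrt I \<sigma> X (X' /\<^sub>R norm X') s"
    using has_deriv_wrtI[OF assms(1-3)] assms(4) by simp
  then show ?thesis
    unfolding unit_tangent_def deriv_wrt_def using has_deriv_wrt_unique[OF \<open>s \<in> I\<close>] by blast
qed

text \<open>The criterion behind all three formulas: near \<open>s\<close> the unit tangent may be
  replaced by an explicit \<open>V\<close> whose derivative is known. Continuity keeps
  \<open>X'\<close> nonzero near \<open>s\<close>, so the unit tangent is well defined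
  there.\<close>

lemma has_tangent_derivI:
  fixes X :: "real \<Rightarrow> 'a::real_normed_vector"
  assumes s: "s \<in> I" and X: "\<And>u. u \<in> I \<Longrightarrow> (X has_vector_derivative X' u) (at u within I)"
    and cont: "continuous_on I X'" and \<sigma>: "arc_length_parameter I X \<sigma>" and "X' s \<noteq> 0"
    and V: "(V has_vector_derivative V') (at s within I)"
    and "0 < d" and V_eq: "\<And>u. u \<in> I \<Longrightarrow> dist u s < d \<Longrightarrow> X' u \<noteq> 0 \<Longrightarrow> V u = X' u /\<^sub>R norm (X' u)"
  shows "has_tangent_deriv I \<sigma> X (V' /\<^sub>R norm (X' s)) s"
proof -
  have X'_eq: "deriv_in I X u = X' u" if "u \<in> I" for u using deriv_in_eq[OF that X[OF that]] .
  have "continuous_on I (deriv_in I X)" using cont by (simp add: X'_eq cong: continuous_on_cong)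
  from arc_length_parameter_deriv[OF \<sigma> this]
  have \<sigma>': "(\<sigma> has_vector_derivative norm (X' u)) (at u within I)" if "u \<in> I" for u
    using X'_eq that by simp
  obtain e where e: "0 < e" "\<And>u. u \<in> I \<Longrightarrow> dist u s < e \<Longrightarrow> X' u \<noteq> 0"
    using continuous_on_avoid[OF cont s \<open>X' s \<noteq> 0\<close>] by (metis dist_commute)
  have "(unit_tangent I \<sigma> X has_vector_derivative V') (at s within I)"
  proof (rule has_vector_derivative_transform_within[OF V _ s])
    show "0 < min d e" using \<open>0 < d\<close> e by simp
    show "V u = unit_tangent I \<sigma> X u" if "u \<in> I" "dist u s < min d e" for u
      using unit_tangent_eq[OF that(1) X \<sigma>'] V_eq e that by simp
  qed
  from has_deriv_wrtI[OF s this \<sigma>'[OF s]] show ?thesis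
    using \<open>X' s \<noteq> 0\<close> by (simp add: has_tangent_deriv_def)
qed

end

section \<open>Vector calculus in Euclidean 3-space\<close>

lemma bounded_bilinear_cross3: "bounded_bilinear cross3"
  using bilinear_cross by (simp add: bilinear_conv_bounded_bilinear)

lemmas has_vector_derivative_cross3 = bounded_bilinear.has_vector_derivative[OF bounded_bilinear_cross3]
lemmas has_vector_derivative_inner = bounded_bilinear.has_vector_derivative[OF bounded_bilinear_inner]

lemma has_real_derivative_norm:
  fixes f :: "real \<Rightarrow> 'a::real_inner"
  assumes "(f has_vector_derivative f') (at s within S)" "f s \<noteq> 0"
  shows "((\<lambda>u. norm (f u)) has_real_derivative (f s \<bullet> f') / norm (f s)) (at s within S)"
proof -
  have "((\<lambda>u. norm (f u)) has_derivative (\<lambda>h. (h *\<^sub>R f') \<bullet> sgn (f s))) (at s within S)"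
    using has_derivative_compose[OF assms(1)[unfolded has_vector_derivative_def]
        has_derivative_norm[OF assms(2)]] by simp
  then show ?thesis
    unfolding has_field_derivative_def
    by (rule has_derivative_eq_rhs)
       (auto simp: sgn_div_norm inner_commute divide_inverse mult_ac)
qed

text \<open>The remainder \<open>e\<close> is orthogonal to \<open>t\<close>, \<open>n\<close> and
  \<open>cross3 t n\<close>. By Lagrange's identity its cross product with \<open>cross3 t n\<close>
  is zero too, so one of these two vectors is zero; the latter has the same length as
  \<open>n\<close>.\<close>

lemma orthogonal_expansion_cross3:
  fixes t n v :: "real^3"
  assumes t: "t \<bullet> t = 1" and tn: "t \<bullet> n = 0" and n: "n \<noteq> 0"
  shows "v = (t \<bullet> v) *\<^sub>R t + ((n \<bullet> v) / (n \<bullet> n)) *\<^sub>R n + ((cross3 t n \<bullet> v) / (n \<bullet> n)) *\<^sub>R cross3 t n"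
proof -
  let ?b = "cross3 t n"
  define e where "e = v - ((t \<bullet> v) *\<^sub>R t + ((n \<bullet> v) / (n \<bullet> n)) *\<^sub>R n + ((?b \<bullet> v) / (n \<bullet> n)) *\<^sub>R ?b)"
  have bb: "?b \<bullet> ?b = n \<bullet> n" using t tn by (simp add: dot_cross inner_commute)
  have et: "t \<bullet> e = 0" and en: "n \<bullet> e = 0" and eb: "?b \<bullet> e = 0"
    unfolding e_def using t tn n bb
    by (simp_all add: inner_diff_right inner_add_right dot_cross_self inner_commute[of n t])
  have "cross3 e ?b = (e \<bullet> n) *\<^sub>R t - (e \<bullet> t) *\<^sub>R n"
    by (rule Lagrange)
  then have "cross3 e ?b = 0" using et en by (simp add: inner_commute)
  then have "e = 0 \<or> ?b = 0" using norm_and_cross_eq_0 eb by (metis inner_commute)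
  then have "e = 0" using bb n by auto
  then show ?thesis by (simp add: e_def)
qed

section \<open>The modified orthogonal frame and its derivative equations\<close>

locale unit_speed_curve = nondegenerate_interval +
  fixes \<alpha> :: "real \<Rightarrow> real^3"
  assumes analytic: "real_analytic_on I \<alpha>" and unit_speed: "unit_speed_on I \<alpha>"
begin

abbreviation "T \<equiv> frame_T I \<alpha>"
abbreviation "N \<equiv> frame_N I \<alpha>"
abbreviation "B \<equiv> frame_B I \<alpha>"
abbreviation "\<kappa> \<equiv> curvature I \<alpha>"
abbreviation "\<tau> \<equiv> torsion I \<alpha>"
abbreviation "w \<equiv> darboux I \<alpha>"
abbreviation "N' \<equiv> deriv_in I N"

lemma frame_T_fun: "T = deriv_in I \<alpha>" and frame_N_fun: "N = deriv_in I T"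
  and frenet_t_fun: "frenet_t I \<alpha> = T"
  by (auto simp: frame_T_def frame_N_def frenet_t_def)

lemma curvature_eq: "\<kappa> s = norm (N s)"
  by (simp add: curvature_def frenet_t_fun frame_N_fun)

lemma curvature_eq_0_iff [simp]: "\<kappa> s = 0 \<longleftrightarrow> N s = 0"
  by (simp add: curvature_eq)

lemma curvature_nonneg: "0 \<le> \<kappa> s"
  by (simp add: curvature_eq)

lemma inner_N_N: "N s \<bullet> N s = (\<kappa> s)\<^sup>2"
  by (simp add: curvature_eq power2_norm_eq_inner)

lemma T_deriv: "s \<in> I \<Longrightarrow> (T has_vector_derivative N s) (at s within I)"
  and N_deriv: "s \<in> I \<Longrightarrow> (N has_vector_derivative N' s) (at s within I)"
  and N'_deriv: "s \<in> I \<Longrightarrow> (N' has_vector_derivative deriv_in I N' s) (at s within I)"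
  unfolding frame_T_fun frame_N_fun
  by (intro real_analytic_on_deriv analytic; assumption)+

lemma B_deriv:
  assumes "s \<in> I"
  shows "(B has_vector_derivative cross3 (T s) (N' s)) (at s within I)"
  unfolding frame_B_def[abs_def]
  \<comment> \<open>The other term of the product rule is the cross product of \<open>N s\<close>
    with itself.\<close>
  using has_vector_derivative_cross3[OF T_deriv[OF assms] N_deriv[OF assms]] by simp

lemma continuous_on_N: "continuous_on I N" and continuous_on_N': "continuous_on I N'"
  unfolding continuous_on_eq_continuous_within
  by (intro ballI has_vector_derivative_continuous, erule N_deriv N'_deriv)+

lemma inner_T_T: "s \<in> I \<Longrightarrow> T s \<bullet> T s = 1"
  using unit_speed by (simp add: unit_speed_on_def frame_T_fun norm_eq_1)

text \<open>Each frame relation is differentiated to obtain the next: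
  \<open>T \<bullet> T = 1\<close> yields \<open>T \<bullet> N = 0\<close>, which yields
  \<open>T \<bullet> N'\<close>.\<close>

lemma derivs_inner_constant:
  fixes f g :: "real \<Rightarrow> 'a::real_inner"
  assumes "s \<in> I" "(f has_vector_derivative f') (at s within I)" "(g has_vector_derivative g') (at s within I)"
    and "\<And>u. u \<in> I \<Longrightarrow> f u \<bullet> g u = c"
  shows "f s \<bullet> g' + f' \<bullet> g s = 0"
proof -
  have "((\<lambda>u. f u \<bullet> g u) has_vector_derivative 0) (at s within I)"
    by (rule has_vector_derivative_transform[OF assms(1) assms(4)]) auto
  from vector_derivative_within[OF at_within_nontrivial[OF assms(1)] this]
    vector_derivative_within[OF at_within_nontrivial[OF assms(1)] has_vector_derivative_inner[OF assms(2,3)]]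
  show ?thesis by simp
qed

lemma inner_T_N: "s \<in> I \<Longrightarrow> T s \<bullet> N s = 0"
  using derivs_inner_constant[OF _ T_deriv T_deriv inner_T_T] by (simp add: inner_commute)

lemma inner_T_N': "s \<in> I \<Longrightarrow> T s \<bullet> N' s = - (\<kappa> s)\<^sup>2"
  using derivs_inner_constant[OF _ T_deriv N_deriv inner_T_N, of s] by (simp add: inner_N_N)

lemma inner_B_B: "s \<in> I \<Longrightarrow> B s \<bullet> B s = (\<kappa> s)\<^sup>2"
  by (simp add: frame_B_def dot_cross inner_T_T inner_T_N inner_N_N)

lemma inner_T_B: "T s \<bullet> B s = 0" and inner_N_B: "N s \<bullet> B s = 0"
  by (simp_all add: frame_B_def dot_cross_self)

text \<open>Here \<open>(N s \<bullet> N' s) / \<kappa> s\<close> is the derivative of the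
  curvature, being the derivative of \<open>norm (N s)\<close>.\<close>

lemma unit_N_deriv:
  assumes "s \<in> I" "N s \<noteq> 0"
  shows "((\<lambda>u. inverse (\<kappa> u)) has_real_derivative - ((N s \<bullet> N' s) / (\<kappa> s)^3)) (at s within I)"
  using has_real_derivative_norm[OF N_deriv] assms unfolding curvature_eq
  by (auto intro!: derivative_eq_intros simp: divide_inverse power3_eq_cube)

text \<open>Frees the torsion from the Frenet vectors. Since \<open>b\<close> is
  \<open>B / \<kappa>\<close>, the product rule gives a multiple of \<open>B\<close>, orthogonal to
  \<open>N\<close>, and a triple product that is rearranged cyclically.\<close>

lemma torsion_eq:
  assumes s: "s \<in> I" and N: "N s \<noteq> 0"
  shows "\<tau> s = (B s \<bullet> N' s) / (\<kappa> s)\<^sup>2"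
proof -
  let ?c = "- ((N s \<bullet> N' s) / (\<kappa> s)^3)"
  have n: "frenet_n I \<alpha> u = N u /\<^sub>R \<kappa> u" for u by (simp add: frenet_n_def frenet_t_fun frame_N_fun)
  have b: "frenet_b I \<alpha> = (\<lambda>u. inverse (\<kappa> u) *\<^sub>R B u)"
    by (auto simp: frenet_b_def n frenet_t_fun frame_B_def cross_mult_right)
  have "(frenet_b I \<alpha> has_vector_derivative (inverse (\<kappa> s) *\<^sub>R cross3 (T s) (N' s) + ?c *\<^sub>R B s)) (at s within I)"
    unfolding b by (rule has_vector_derivative_scaleR[OF unit_N_deriv B_deriv]) (use s N in auto)
  from deriv_in_eq[OF s this] have "\<tau> s = - ((inverse (\<kappa> s) *\<^sub>R cross3 (T s) (N' s) + ?c *\<^sub>R B s) \<bullet> (N s /\<^sub>R \<kappa> s))"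
    by (simp add: torsion_def n)
  also have "\<dots> = - (cross3 (T s) (N' s) \<bullet> N s) / (\<kappa> s)\<^sup>2"
    by (simp add: inner_diff_left inner_add_left inner_N_B inner_commute[of "B s"] divide_inverse
        power2_eq_square del: curvature_eq_0_iff)
  also have "cross3 (T s) (N' s) \<bullet> N s = - (B s \<bullet> N' s)"
    by (simp add: frame_B_def cross3_simps)
  finally show ?thesis by simp
qed

text \<open>The second frame equation; the coefficient of \<open>N s\<close> is the logarithmic
  derivative of the curvature.\<close>

lemma N'_eq:
  assumes s: "s \<in> I" and N: "N s \<noteq> 0"
  shows "N' s = - (\<kappa> s)\<^sup>2 *\<^sub>R T s + ((N s \<bullet> N' s) / (\<kappa> s)\<^sup>2) *\<^sub>R N s + \<tau> s *\<^sub>R B s"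
  using orthogonal_expansion_cross3[OF inner_T_T[OF s] inner_T_N[OF s] N, of "N' s"]
  by (simp add: inner_T_N'[OF s] inner_N_N torsion_eq[OF s N] frame_B_def)

section \<open>The curve traced by \<open>T\<close>\<close>

lemma tangent_indicatrix:
  assumes s: "s \<in> I" and "\<kappa> s \<noteq> 0" and \<sigma>: "arc_length_parameter I T \<sigma>"
  shows "has_tangent_deriv I \<sigma> T (- T s + (\<tau> s / (\<kappa> s)\<^sup>2) *\<^sub>R B s) s"
proof -
  have N: "N s \<noteq> 0" using assms(2) by simp
  let ?V' = "inverse (\<kappa> s) *\<^sub>R N' s + - ((N s \<bullet> N' s) / (\<kappa> s)^3) *\<^sub>R N s"
  have "((\<lambda>u. inverse (\<kappa> u) *\<^sub>R N u) has_vector_derivative ?V') (at s within I)"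
    by (rule has_vector_derivative_scaleR[OF unit_N_deriv N_deriv]) (use s N in auto)
  from has_tangent_derivI[OF s T_deriv continuous_on_N \<sigma> N this, of 1]
  have "has_tangent_deriv I \<sigma> T (?V' /\<^sub>R \<kappa> s) s" by (simp add: curvature_eq)
  \<comment> \<open>The \<open>N\<close>-component of \<open>N' / \<kappa>\<close> cancels against
    the term from differentiating \<open>1 / \<kappa>\<close>.\<close>
  also have "?V' /\<^sub>R \<kappa> s = - T s + (\<tau> s / (\<kappa> s)\<^sup>2) *\<^sub>R B s"
    using N by (subst N'_eq[OF s N])
      (simp add: scaleR_add_right scaleR_diff_right field_simps power2_eq_square power3_eq_cube)
  finally show ?thesis .
qed

end

section \<open>Frame equations and Darboux vector for constant curvature\<close>

locale constant_curvature_curve = unit_speed_curve +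
  fixes c :: real
  assumes curvature_const: "s \<in> I \<Longrightarrow> \<kappa> s = c" and c_pos: "0 < c"
begin

lemma N_nonzero: "s \<in> I \<Longrightarrow> N s \<noteq> 0"
  using curvature_const[of s] c_pos by (auto simp: curvature_eq)

lemma inner_N_N': "s \<in> I \<Longrightarrow> N s \<bullet> N' s = 0"
  using derivs_inner_constant[OF _ N_deriv N_deriv, of s "c\<^sup>2"]
  by (simp add: inner_N_N curvature_const inner_commute)

lemma N'_eq_const: "s \<in> I \<Longrightarrow> N' s = - c\<^sup>2 *\<^sub>R T s + \<tau> s *\<^sub>R B s"
  using N'_eq[OF _ N_nonzero, of s] by (simp add: inner_N_N' curvature_const)

lemma B_deriv_const:
  assumes "s \<in> I"
  shows "(B has_vector_derivative - \<tau> s *\<^sub>R N s) (at s within I)"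
proof -
  \<comment> \<open>\<open>B\<close> is \<open>cross3 T N\<close>, so this is a double cross
    product. The \<open>T\<close>-component of \<open>N'\<close> contributes nothing to
    \<open>cross3 T N'\<close>.\<close>
  have "cross3 (T s) (B s) = - N s"
    using inner_T_T[OF assms] inner_T_N[OF assms] Lagrange[of "T s" "T s" "N s"] by (simp add: frame_B_def)
  then have "cross3 (T s) (N' s) = - \<tau> s *\<^sub>R N s"
    by (simp add: N'_eq_const[OF assms] Cross3.right_diff_distrib cross_mult_right)
  then show ?thesis using B_deriv[OF assms] by simp
qed

text \<open>With constant curvature the torsion is \<open>B \<bullet> N'\<close> divided by a
  constant, and both factors are differentiable.\<close>

lemma torsion_deriv: "s \<in> I \<Longrightarrow> \<exists>\<tau>'. (\<tau> has_real_derivative \<tau>') (at s within I)"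
proof -
  assume s: "s \<in> I"
  have "((\<lambda>u. B u \<bullet> N' u) has_real_derivative (B s \<bullet> deriv_in I N' s + (- \<tau> s *\<^sub>R N s) \<bullet> N' s)) (at s within I)"
    using has_vector_derivative_inner[OF B_deriv_const[OF s] N'_deriv[OF s]]
    by (simp only: has_real_derivative_iff_has_vector_derivative)
  note deriv = DERIV_cdivide[OF this, of "c\<^sup>2"]
  have "B u \<bullet> N' u / c\<^sup>2 = \<tau> u" if "u \<in> I" for u
    using torsion_eq[OF that N_nonzero[OF that]] curvature_const[OF that] by simp
  from has_field_derivative_transform_within[OF deriv zero_less_one s this] show ?thesis by blast
qed

lemma norm_darboux: "s \<in> I \<Longrightarrow> (norm (w s))\<^sup>2 = c\<^sup>2 + (\<tau> s)\<^sup>2"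
  unfolding power2_norm_eq_inner darboux_def
  by (simp add: inner_add_left inner_add_right inner_T_T inner_T_B inner_B_B
      inner_commute[of "B s" "T s"] curvature_const power2_eq_square)

lemma norm_darboux_pos:
  assumes "s \<in> I"
  shows "0 < norm (w s)"
proof -
  have "0 < (norm (w s))\<^sup>2"
    using c_pos by (simp only: norm_darboux[OF assms] add_pos_nonneg zero_less_power zero_le_power2)
  then show ?thesis by simp
qed

text \<open>By orthogonality the squared norm is \<open>c^4 + \<tau>^2 c^2\<close>. Thus the curve
  traced by \<open>N\<close> has positive speed even where the torsion vanishes.\<close>

lemma norm_N': "s \<in> I \<Longrightarrow> norm (N' s) = c * norm (w s)"
proof -
  assume s: "s \<in> I"
  have "(norm (N' s))\<^sup>2 = (c * norm (w s))\<^sup>2"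
    unfolding power_mult_distrib norm_darboux[OF s] unfolding power2_norm_eq_inner N'_eq_const[OF s]
    by (simp add: inner_diff_left inner_diff_right inner_T_T[OF s] inner_T_B inner_B_B[OF s]
      inner_commute[of "B s" "T s"] curvature_const[OF s] power2_eq_square algebra_simps)
  then show ?thesis using c_pos by (simp add: power2_eq_iff_nonneg)
qed

section \<open>The curve traced by \<open>B\<close>\<close>

lemma binormal_indicatrix:
  assumes s: "s \<in> I" and \<tau>: "\<tau> s \<noteq> 0" and \<sigma>: "arc_length_parameter I B \<sigma>"
  shows "has_tangent_deriv I \<sigma> B ((1 / \<tau> s) *\<^sub>R T s - (1 / (\<kappa> s)\<^sup>2) *\<^sub>R B s) s"
proof -
  \<comment> \<open>The sign of the torsion is frozen at \<open>s\<close>, so that \<open>V\<close>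
    is a constant multiple of \<open>N\<close>; this is legitimate because the sign is locally
    constant where the torsion is nonzero.\<close>
  let ?m = "- sgn (\<tau> s) / c"
  have cont: "continuous_on I \<tau>"
    using torsion_deriv by (meson DERIV_continuous continuous_on_eq_continuous_within)
  have cont': "continuous_on I (\<lambda>u. - \<tau> u *\<^sub>R N u)"
    by (intro continuous_intros cont continuous_on_N)
  have ne: "- \<tau> s *\<^sub>R N s \<noteq> 0" using \<tau> N_nonzero[OF s] by simp
  obtain d where d: "0 < d" "\<And>u. u \<in> I \<Longrightarrow> dist u s < d \<Longrightarrow> sgn (\<tau> u) = sgn (\<tau> s)"
  proof -
    obtain d where d: "0 < d" "\<And>u. u \<in> I \<Longrightarrow> dist u s < d \<Longrightarrow> \<bar>\<tau> u - \<tau> s\<bar> < \<bar>\<tau> s\<bar>"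
      using cont s \<tau> unfolding continuous_on_iff dist_real_def by (metis zero_less_abs_iff)
    have "sgn (\<tau> u) = sgn (\<tau> s)" if "u \<in> I" "dist u s < d" for u
      \<comment> \<open>A number closer to \<open>\<tau> s\<close> than
        \<open>\<bar>\<tau> s\<bar>\<close> has the same sign.\<close>
      using d(2)[OF that] by (auto simp: sgn_real_def abs_if split: if_splits)
    with d(1) that show ?thesis by blast
  qed
  have V: "((\<lambda>u. ?m *\<^sub>R N u) has_vector_derivative ?m *\<^sub>R N' s) (at s within I)"
    using N_deriv[OF s] by (auto intro!: derivative_eq_intros)
  have "has_tangent_deriv I \<sigma> B ((?m *\<^sub>R N' s) /\<^sub>R norm (- \<tau> s *\<^sub>R N s)) s"
  proof (rule has_tangent_derivI[OF s B_deriv_const cont' \<sigma> ne V d(1)])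
    show "?m *\<^sub>R N u = (- \<tau> u *\<^sub>R N u) /\<^sub>R norm (- \<tau> u *\<^sub>R N u)" if "u \<in> I" "dist u s < d" for u
      using curvature_const[OF that(1)] d(2)[OF that] c_pos
      by (simp add: curvature_eq sgn_div_norm divide_inverse mult_ac)
  qed
  \<comment> \<open>The sign combines with the absolute torsion in the speed to give the total
    factor \<open>- 1 / (c^2 \<tau>)\<close> on \<open>N'\<close>.\<close>
  also have "(?m *\<^sub>R N' s) /\<^sub>R norm (- \<tau> s *\<^sub>R N s) = (1 / \<tau> s) *\<^sub>R T s - (1 / (\<kappa> s)\<^sup>2) *\<^sub>R B s"
    using \<tau> c_pos curvature_const[OF s] unfolding N'_eq_const[OF s]
    by (cases "0 < \<tau> s")
       (simp_all add: curvature_eq scaleR_diff_right scaleR_add_right field_simps power2_eq_square)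
  finally show ?thesis .
qed

section \<open>The Darboux angle and the curve traced by \<open>N\<close>\<close>

lemma darboux_angle_deriv:
  assumes \<phi>: "darboux_angle I \<alpha> \<phi>" and s: "s \<in> I"
  shows "(\<phi> has_real_derivative deriv_in I \<phi> s) (at s within I)"
proof -
  define g where "g u = sin (\<phi> u - \<phi> s)" for u
  obtain \<tau>' where \<tau>': "(\<tau> has_real_derivative \<tau>') (at s within I)" using torsion_deriv[OF s] by blast
  \<comment> \<open>An explicit function of the torsion that agrees with \<open>norm (w u)\<close>
    on \<open>I\<close>, so its differentiability follows from that of the torsion.\<close>
  define W where "W u = sqrt (c\<^sup>2 + (\<tau> u)\<^sup>2)" for u
  have W: "W u = norm (w u)" if "u \<in> I" for u
    using norm_darboux[OF that] unfolding W_def by (metis norm_ge_zero real_sqrt_unique)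
  have pos: "0 < c\<^sup>2 + (\<tau> u)\<^sup>2" for u using c_pos by (simp add: add_pos_nonneg)
  \<comment> \<open>The subtraction formula for the sine, with the functions of
    \<open>\<phi> u\<close> replaced by their prescribed quotients; the angle itself occurs only
    through the constant \<open>\<phi> s\<close>.\<close>
  have "\<exists>D. ((\<lambda>u. \<tau> u / W u * cos (\<phi> s) - c / W u * sin (\<phi> s)) has_real_derivative D) (at s within I)"
    unfolding W_def using pos[of s]
    by (intro exI) (auto intro!: derivative_eq_intros \<tau>' refl)
  then obtain D where "((\<lambda>u. \<tau> u / W u * cos (\<phi> s) - c / W u * sin (\<phi> s)) has_real_derivative D) (at s within I)" ..
  then have g: "(g has_real_derivative D) (at s within I)"
    by (rule has_field_derivative_transform_within[OF _ zero_less_one s])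
       (use \<phi> in \<open>simp add: g_def sin_diff darboux_angle_def curvature_const W\<close>)
  \<comment> \<open>Since \<open>g s = 0\<close> and \<open>arcsin\<close> has derivative 1 at 0,
    the value \<open>D\<close> is unchanged.\<close>
  have "((\<lambda>u. arcsin (g u)) has_real_derivative D) (at s within I)"
    using DERIV_chain2[of arcsin "inverse (sqrt (1 - (g s)\<^sup>2))" g s, OF _ g] DERIV_arcsin[of "g s"]
    by (simp add: g_def)
  from DERIV_add[OF DERIV_const[of "\<phi> s"] this]
  have "((\<lambda>u. \<phi> s + arcsin (g u)) has_real_derivative D) (at s within I)" by simp
  moreover obtain d where d: "0 < d" "\<And>u. u \<in> I \<Longrightarrow> dist u s < d \<Longrightarrow> \<bar>\<phi> u - \<phi> s\<bar> < pi / 2"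
    using \<phi> s pi_half_gt_zero unfolding darboux_angle_def continuous_on_iff dist_real_def by metis
  moreover have "\<phi> s + arcsin (g u) = \<phi> u" if "u \<in> I" "dist u s < d" for u
  proof -
    have "- (pi / 2) \<le> \<phi> u - \<phi> s" "\<phi> u - \<phi> s \<le> pi / 2" using d(2)[OF that] by linarith+
    from arcsin_sin[OF this] show ?thesis by (simp add: g_def)
  qed
  ultimately have "(\<phi> has_real_derivative D) (at s within I)"
    using has_field_derivative_transform_within[OF _ d(1) s] by blast
  moreover from this have "deriv_in I \<phi> s = D"
    by (intro deriv_in_eq[OF s]) (simp add: has_real_derivative_iff_has_vector_derivative)
  ultimately show ?thesis by simp
qed

lemma normal_indicatrix:
  assumes \<phi>: "darboux_angle I \<alpha> \<phi>" and s: "s \<in> I" and \<sigma>: "arc_length_parameter I N \<sigma>"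
  shows "has_tangent_deriv I \<sigma> N
    ((deriv_in I \<phi> s / ((\<kappa> s)\<^sup>2 * norm (w s))) *\<^sub>R ((\<kappa> s * sin (\<phi> s)) *\<^sub>R T s + cos (\<phi> s) *\<^sub>R B s)
      - (1 / (\<kappa> s)\<^sup>2) *\<^sub>R N s) s"
proof -
  let ?p = "deriv_in I \<phi> s"
  have sin: "sin (\<phi> u) = \<tau> u / norm (w u)" and cos: "cos (\<phi> u) = c / norm (w u)" if "u \<in> I" for u
    using \<phi> that by (auto simp: darboux_angle_def curvature_const)
  \<comment> \<open>This is \<open>N' / norm N'\<close>, that is
    \<open>(- c^2 T + \<tau> B) / (c * norm w)\<close>, rewritten in terms of the angle.\<close>
  define V where "V u = (- cos (\<phi> u)) *\<^sub>R T u + (sin (\<phi> u) / c) *\<^sub>R B u" for u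
  define V' where "V' = ((- cos (\<phi> s)) *\<^sub>R N s + (sin (\<phi> s) * ?p) *\<^sub>R T s)
    + ((sin (\<phi> s) / c) *\<^sub>R (- \<tau> s *\<^sub>R N s) + (cos (\<phi> s) * ?p / c) *\<^sub>R B s)"
  note \<phi>' = darboux_angle_deriv[OF \<phi> s]
  have V: "(V has_vector_derivative V') (at s within I)"
    unfolding V_def[abs_def] V'_def using c_pos
    by (intro has_vector_derivative_add has_vector_derivative_scaleR T_deriv B_deriv_const s)
       (auto intro!: derivative_eq_intros \<phi>')
  have ne: "N' s \<noteq> 0" using norm_N'[OF s] norm_darboux_pos[OF s] c_pos by force
  have "has_tangent_deriv I \<sigma> N (V' /\<^sub>R norm (N' s)) s"
  proof (rule has_tangent_derivI[OF s N_deriv continuous_on_N' \<sigma> ne V zero_less_one])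
    show "V u = N' u /\<^sub>R norm (N' u)" if u: "u \<in> I" for u
      using norm_darboux_pos[OF u] c_pos
      unfolding norm_N'[OF u] unfolding N'_eq_const[OF u] V_def sin[OF u] cos[OF u]
      by (simp add: scaleR_diff_right scaleR_add_right field_simps power2_eq_square)
  qed
  also have "V' /\<^sub>R norm (N' s) = (?p / ((\<kappa> s)\<^sup>2 * norm (w s))) *\<^sub>R ((\<kappa> s * sin (\<phi> s)) *\<^sub>R T s + cos (\<phi> s) *\<^sub>R B s)
      - (1 / (\<kappa> s)\<^sup>2) *\<^sub>R N s"
  proof -
    \<comment> \<open>Up to sign this is the coefficient of \<open>N\<close> in \<open>V'\<close>:
      the left side is \<open>(c^2 + \<tau>^2) / (c * norm w)\<close>. Division by the speed
      \<open>c * norm w\<close> then leaves \<open>1 / c^2\<close>.\<close>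
    have *: "cos (\<phi> s) + sin (\<phi> s) / c * \<tau> s = norm (w s) / c"
      using norm_darboux[OF s] norm_darboux_pos[OF s] c_pos unfolding sin[OF s] cos[OF s]
      by (simp add: field_simps power2_eq_square)
    have V'_eq: "V' = ?p *\<^sub>R (sin (\<phi> s) *\<^sub>R T s + (cos (\<phi> s) / c) *\<^sub>R B s) - (norm (w s) / c) *\<^sub>R N s"
      unfolding V'_def *[symmetric] by (simp add: algebra_simps)
    show ?thesis
      using norm_darboux_pos[OF s] c_pos unfolding V'_eq norm_N'[OF s] curvature_const[OF s]
      by (simp add: scaleR_diff_right scaleR_add_right field_simps power2_eq_square)
  qed
  finally show ?thesis .
qed

end

section \<open>Assembling the three formulas\<close>

text \<open>A constant curvature that is nonzero somewhere is positive everywhere on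
  \<open>I\<close>.\<close>

lemma constant_curvature_curveI:
  assumes "unit_speed_curve I \<alpha>" and const: "curvature I \<alpha> constant_on I"
    and nonzero: "\<exists>s\<in>I. curvature I \<alpha> s \<noteq> 0" and u: "u \<in> I"
  shows "constant_curvature_curve I \<alpha> (curvature I \<alpha> u)"
proof -
  interpret unit_speed_curve I \<alpha> by fact
  have eq: "\<kappa> v = \<kappa> u" if "v \<in> I" for v
    using const that u unfolding constant_on_def by metis
  obtain v where "v \<in> I" "\<kappa> v \<noteq> 0" using nonzero by blast
  then have "0 < \<kappa> u" using eq[of v] curvature_nonneg[of u] by linarith
  with eq show ?thesis by unfold_locales
qed

theorem theorem4p2:
  fixes I :: "real set" and \<alpha> :: "real \<Rightarrow> real^3" and \<phi> s\<^sub>T s\<^sub>N s\<^sub>B :: "real \<Rightarrow> real"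
  assumes "is_interval I" and "interior I \<noteq> {}"
    and "real_analytic_on I \<alpha>"
    and "unit_speed_on I \<alpha>"
    and "\<exists>s\<in>I. curvature I \<alpha> s \<noteq> 0"
    and "arc_length_parameter I (frame_T I \<alpha>) s\<^sub>T"
    and "arc_length_parameter I (frame_N I \<alpha>) s\<^sub>N"
    and "arc_length_parameter I (frame_B I \<alpha>) s\<^sub>B"
  shows "(\<forall>s\<in>I. curvature I \<alpha> s \<noteq> 0 \<longrightarrow>
            has_tangent_deriv I s\<^sub>T (frame_T I \<alpha>)
              (- frame_T I \<alpha> s
               + (torsion I \<alpha> s / (curvature I \<alpha> s)\<^sup>2) *\<^sub>R frame_B I \<alpha> s) s)
    \<and> (curvature I \<alpha> constant_on I \<longrightarrow>
         (darboux_angle I \<alpha> \<phi> \<longrightarrow>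
            (\<forall>s\<in>I. has_tangent_deriv I s\<^sub>N (frame_N I \<alpha>)
              ((deriv_in I \<phi> s / ((curvature I \<alpha> s)\<^sup>2 * norm (darboux I \<alpha> s))) *\<^sub>R
                 ((curvature I \<alpha> s * sin (\<phi> s)) *\<^sub>R frame_T I \<alpha> s
                  + cos (\<phi> s) *\<^sub>R frame_B I \<alpha> s)
               - (1 / (curvature I \<alpha> s)\<^sup>2) *\<^sub>R frame_N I \<alpha> s) s))
         \<and> (\<forall>s\<in>I. torsion I \<alpha> s \<noteq> 0 \<longrightarrow>
              has_tangent_deriv I s\<^sub>B (frame_B I \<alpha>)
                ((1 / torsion I \<alpha> s) *\<^sub>R frame_T I \<alpha> s
                 - (1 / (curvature I \<alpha> s)\<^sup>2) *\<^sub>R frame_B I \<alpha> s) s))"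
proof -
  have curve: "unit_speed_curve I \<alpha>"
    using assms(1-4) by unfold_locales
  \<comment> \<open>The constant \<open>c\<close> is taken to be the curvature at the point of
    \<open>I\<close> under consideration.\<close>
  note const = constant_curvature_curveI[OF curve _ assms(5)]
  show ?thesis
    by (intro conjI impI ballI assms(6-8) unit_speed_curve.tangent_indicatrix[OF curve]
        constant_curvature_curve.normal_indicatrix[OF const]
        constant_curvature_curve.binormal_indicatrix[OF const]; assumption)
qed

end
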